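(* Let $d\in\mathbb{N}$, let $\phi\colon (0,\infty)\to (0,\infty)$ be an increasing, concave function with $\phi(R)\in o(R)$ and let $X\subseteq \mathbb{R}^{d}$ be a separated net. Then there exists a separated net $Y\subseteq \mathbb{R}^{d}$ such that every bijection $f\colon X\to Y$ satisfies $\operatorname{disp}_{R}(f)\notin o(\phi(R))$, and there exists a bijection $g\colon X\to Y$ with $\operatorname{disp}_{R}(g)\in O(\phi(R))$ and $\operatorname{disp}_{R}(g^{-1})\in O(\phi(R))$. Moreover, such a $Y$ can be found so that $X$ and $Y$ are bilipschitz equivalent.
   Context: A set $Z\subseteq\mathbb{R}^d$ is separated if $\inf\{\|z-z'\|_2: z,z'\in Z,\ z\ne z'\}>0$, and a net of $\mathbb{R}^d$ if $\sup_{x\in\mathbb{R}^d}\inf_{z\in Z}\|z-x\|_2<\infty$; a separated net is a set that is both. A function $\phi$ is increasing if $s\le t$ implies $\phi(s)\le\phi(t)$. For $f\colon A\subseteq\mathbb{R}^d\to\mathbb{R}^d$ and $R>0$, $\operatorname{disp}_R(f):=\sup\{\|f(x)-x\|_2: x\in A,\ \|x\|_2\le R\}$, with $\operatorname{disp}_R(f):=0$ if $A\cap\overline{B}(\mathbf{0},R)=\emptyset$; it is regarded as a function of $R\in(0,\infty)$. Asymptotic notation is for $R\to\infty$: $u(R)\in O(v(R))$ means $\limsup_{R\to\infty}u(R)/v(R)<\infty$ and $u(R)\in o(v(R))$ means $\limsup_{R\to\infty}u(R)/v(R)=0$. Two separated nets $X,Y\subseteq\mathbb{R}^d$ are bilipschitz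 equivalent if there is a bijection $X\to Y$ that is Lipschitz with Lipschitz inverse (with respect to the Euclidean distance). *)

theory Defs
  imports "HOL-Analysis.Analysis" "HOL-Library.Landau_Symbols"
begin

text \<open>
  Infima and suprema over possibly empty or unbounded families are taken in \<^typ>\<open>ereal\<close>,
  so that the infimum over the empty family is \<open>\<infinity>\<close>: sets with at most one point are separated,
  and the empty set is not a net.
\<close>

definition separated :: "'a::euclidean_space set \<Rightarrow> bool" where
  "separated Z \<longleftrightarrow> (INF (z, z') \<in> {(z, z'). z \<in> Z \<and> z' \<in> Z \<and> z \<noteq> z'}. ereal (norm (z - z'))) > 0"

definition net :: "'a::euclidean_space set \<Rightarrow> bool" where
  "net Z \<longleftrightarrow> (SUP x. INF z\<in>Z. ereal (norm (z - x))) < \<infinity>"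

definition separated_net :: "'a::euclidean_space set \<Rightarrow> bool" where
  "separated_net Z \<longleftrightarrow> separated Z \<and> net Z"

text \<open>
  A map \<open>f : A \<rightarrow> \<real>\<^sup>d\<close> is a total function of which only the values on \<open>A\<close> matter.  The supremum is
  real-valued, hence meaningful only where the displacement is bounded on \<open>A \<inter> cball 0 R\<close>.  For
  separated \<open>A\<close> this intersection is finite (\<open>separated_finite_Int_cball\<close> below).
\<close>

definition disp :: "'a::euclidean_space set \<Rightarrow> ('a \<Rightarrow> 'a) \<Rightarrow> real \<Rightarrow> real" where
  "disp A f R = (if A \<inter> cball 0 R = {} then 0 else (SUP x \<in> A \<inter> cball 0 R. norm (f x - x)))"

definition bilipschitz_equivalent :: "'a::euclidean_space set \<Rightarrow> 'a set \<Rightarrow> bool" where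
  "bilipschitz_equivalent X Y \<longleftrightarrow>
     (\<exists>h. bij_betw h X Y \<and> (\<exists>L. L-lipschitz_on X h) \<and> (\<exists>M. M-lipschitz_on Y (inv_into X h)))"

lemma separated_iff:
  "separated Z \<longleftrightarrow> (\<exists>\<delta>>0. \<forall>z\<in>Z. \<forall>z'\<in>Z. z \<noteq> z' \<longrightarrow> \<delta> \<le> dist z z')"
proof
  assume "separated Z"
  then have "(INF (z, z') \<in> {(z, z'). z \<in> Z \<and> z' \<in> Z \<and> z \<noteq> z'}. ereal (norm (z - z'))) > 0"
    by (simp add: separated_def)
  then obtain \<delta> where \<delta>: "0 < ereal \<delta>"
    "ereal \<delta> < (INF (z, z') \<in> {(z, z'). z \<in> Z \<and> z' \<in> Z \<and> z \<noteq> z'}. ereal (norm (z - z')))"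
    using ereal_dense2 by blast
  have "\<delta> \<le> dist z z'" if "z \<in> Z" "z' \<in> Z" "z \<noteq> z'" for z z'
  proof -
    have "ereal \<delta> < ereal (norm (z - z'))"
      using less_INF_D[OF \<delta>(2), of "(z, z')"] that by simp
    then show ?thesis by (simp add: dist_norm)
  qed
  then show "\<exists>\<delta>>0. \<forall>z\<in>Z. \<forall>z'\<in>Z. z \<noteq> z' \<longrightarrow> \<delta> \<le> dist z z'"
    using \<delta>(1) by auto
next
  assume "\<exists>\<delta>>0. \<forall>z\<in>Z. \<forall>z'\<in>Z. z \<noteq> z' \<longrightarrow> \<delta> \<le> dist z z'"
  then obtain \<delta> where \<delta>: "\<delta> > 0" "\<And>z z'. z \<in> Z \<Longrightarrow> z' \<in> Z \<Longrightarrow> z \<noteq> z' \<Longrightarrow> \<delta> \<le> dist z z'"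
    by blast
  have "ereal \<delta> \<le> (INF (z, z') \<in> {(z, z'). z \<in> Z \<and> z' \<in> Z \<and> z \<noteq> z'}. ereal (norm (z - z')))"
    using \<delta>(2) by (intro INF_greatest) (auto simp: dist_norm)
  then show "separated Z"
    unfolding separated_def using \<delta>(1) by (meson ereal_less(2) less_le_trans)
qed

lemma net_iff: "net Z \<longleftrightarrow> (\<exists>r. \<forall>x. \<exists>z\<in>Z. dist z x \<le> r)"
proof
  assume "net Z"
  then obtain r where r: "(SUP x. INF z\<in>Z. ereal (norm (z - x))) < ereal r"
    unfolding net_def using ereal_dense2 by blast
  have "\<exists>z\<in>Z. dist z x \<le> r" for x
  proof -
    have "(INF z\<in>Z. ereal (norm (z - x))) < ereal r"
      using SUP_lessD[OF r] by simp
    then show ?thesis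
      by (auto simp: INF_less_iff dist_norm intro: less_imp_le)
  qed
  then show "\<exists>r. \<forall>x. \<exists>z\<in>Z. dist z x \<le> r" by blast
next
  assume "\<exists>r. \<forall>x. \<exists>z\<in>Z. dist z x \<le> r"
  then obtain r where r: "\<And>x. \<exists>z\<in>Z. dist z x \<le> r" by blast
  have "(SUP x. INF z\<in>Z. ereal (norm (z - x))) \<le> ereal r"
  proof (rule SUP_least)
    fix x
    obtain z where "z \<in> Z" "dist z x \<le> r" using r by blast
    then show "(INF z\<in>Z. ereal (norm (z - x))) \<le> ereal r"
      by (intro INF_lower2[of z]) (auto simp: dist_norm)
  qed
  then show "net Z"
    unfolding net_def using le_less_trans by fastforce
qed

lemma separated_iff_uniform_discrete: "separated Z \<longleftrightarrow> uniform_discrete Z"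
  unfolding separated_iff uniform_discrete_def by (meson not_le)

lemma separated_finite_Int_cball:
  assumes "separated A"
  shows "finite (A \<inter> cball 0 R)"
proof (rule ccontr)
  assume inf: "infinite (A \<inter> cball 0 R)"
  obtain e where e: "e > 0" "\<forall>x\<in>A \<inter> cball 0 R. \<forall>y\<in>A \<inter> cball 0 R. dist y x < e \<longrightarrow> y = x"
    using assms unfolding separated_iff_uniform_discrete uniform_discrete_def by blast
  obtain l where "l islimpt (A \<inter> cball 0 R)"
    using Heine_Borel_imp_Bolzano_Weierstrass[OF compact_cball inf] by auto
  then show False
    using discrete_imp_not_islimpt[OF e(1), of "A \<inter> cball 0 R" l] e(2) by blast
qed

end

theory Submission
  imports Defs
begin

text \<open>
  The net \<open>Y\<close> is obtained by pushing every point \<open>x\<close> of \<open>X\<close> radially outwards by \<open>\<psi> \<parallel>x\<parallel>\<close>, where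
  \<open>\<psi> = C \<phi>\<close> for a large constant \<open>C\<close>.  The push moves points of norm at most \<open>R\<close> by at most \<open>\<psi> R\<close>,
  and never decreases norms, so it is itself a bijection with the required upper bounds, for its
  inverse as well.

  It is bilipschitz on \<open>X\<close> for two reasons.  The displacement \<open>x \<mapsto> \<psi> \<parallel>x\<parallel> x / \<parallel>x\<parallel>\<close> is the gradient
  of a convex function, hence a monotone operator, and so the push does not decrease distances
  (\<open>radial_push_expands\<close>).  Concavity and positivity make \<open>\<psi> t / t\<close> decreasing, which bounds how
  much the push can stretch a pair of points away from the origin (\<open>radial_push_stretch\<close>), and two
  distinct points of a separated set cannot both be close to the origin.

  The lower bound is a counting argument for large \<open>R\<close> (\<open>not_less_displaced\<close>).  A point of \<open>Y\<close> in the ball of radius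
  \<open>R\<close> comes from a point of \<open>X\<close> of norm at most \<open>R - \<psi> R / 2\<close>.  A bijection \<open>f\<close> from \<open>X\<close> to \<open>Y\<close> with
  displacement at most \<open>\<psi> R / 4\<close> would map the points of \<open>X\<close> of norm at most \<open>R - \<psi> R / 4\<close> into that
  ball, so \<open>X\<close> would miss an annulus of width \<open>\<psi> R / 4\<close>.  Since \<open>\<phi>\<close> is increasing and positive, a
  large \<open>C\<close> makes all these annuli too wide to be missed by \<open>X\<close>, even when \<open>\<phi>\<close> is bounded.
\<close>

section \<open>Concave profiles and the radial push\<close>

text \<open>At the origin the quotient is \<open>0\<close> by the convention on division, and the origin stays fixed.\<close>

definition radial_push :: "(real \<Rightarrow> real) \<Rightarrow> 'a::euclidean_space \<Rightarrow> 'a" where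
  "radial_push \<psi> x = x + (\<psi> (norm x) / norm x) *\<^sub>R x"

locale concave_profile =
  fixes \<psi> :: "real \<Rightarrow> real"
  assumes pos: "t > 0 \<Longrightarrow> \<psi> t > 0"
    and mono: "mono_on {0<..} \<psi>"
    and concave: "concave_on {0<..} \<psi>"
begin

lemma increasing: "0 < s \<Longrightarrow> s \<le> t \<Longrightarrow> \<psi> s \<le> \<psi> t"
  using mono by (auto simp: mono_on_def)

text \<open>
  A concave function that is positive near \<open>0\<close> lies above its chords to the origin.  If the value
  at \<open>s\<close> were below the chord to \<open>t\<close>, then \<open>s\<close> would be the convex combination of \<open>t\<close>, with the
  weight \<open>\<psi> s / \<psi> t < s / t\<close>, and of a point \<open>u > 0\<close>; concavity would give \<open>\<psi> s > \<psi> s\<close>.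
\<close>

lemma ratio_decreasing:
  assumes "0 < s" "s \<le> t"
  shows "\<psi> t / t \<le> \<psi> s / s"
proof (rule ccontr)
  define l where "l = \<psi> s / \<psi> t"
  assume "\<not> \<psi> t / t \<le> \<psi> s / s"
  then have lt: "l * t < s"
    using assms pos[of t] by (simp add: l_def field_simps)
  then have "l * t < 1 * t"
    using assms by linarith
  then have l1: "l < 1"
    using mult_right_less_imp_less[of l t 1] assms by linarith
  have l0: "0 < l"
    using assms pos[of s] pos[of t] by (simp add: l_def)
  define u where "u = (s - l * t) / (1 - l)"
  have u: "u > 0"
    using lt l1 by (simp add: u_def)
  have s: "l * t + (1 - l) * u = s"
    using l1 by (simp add: u_def)
  have "l * \<psi> t + (1 - l) * \<psi> u \<le> \<psi> (l * t + (1 - l) * u)"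
    using concave_onD[OF concave, of "1 - l" t u] l0 l1 u assms by simp
  moreover have "l * \<psi> t = \<psi> s"
    using pos[of t] assms by (simp add: l_def)
  moreover have "(1 - l) * \<psi> u > 0"
    using l1 pos[OF u] by simp
  ultimately show False
    unfolding s by linarith
qed

lemma norm_displacement:
  fixes x :: "'a::euclidean_space"
  shows "x \<noteq> 0 \<Longrightarrow> norm (radial_push \<psi> x - x) = \<psi> (norm x)"
  using pos[of "norm x"] by (simp add: radial_push_def)

lemma norm_displacement_le:
  fixes x :: "'a::euclidean_space"
  assumes "norm x \<le> R" "R > 0"
  shows "norm (radial_push \<psi> x - x) \<le> \<psi> R"
proof (cases "x = 0")
  case True
  then show ?thesis
    using pos[of R] assms by (simp add: radial_push_def)
next
  case False
  then show ?thesis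
    using increasing[of "norm x" R] assms by (simp add: norm_displacement)
qed

lemma norm_radial_push:
  fixes x :: "'a::euclidean_space"
  assumes "x \<noteq> 0"
  shows "norm (radial_push \<psi> x) = norm x + \<psi> (norm x)"
proof -
  have "radial_push \<psi> x = (1 + \<psi> (norm x) / norm x) *\<^sub>R x"
    by (simp add: radial_push_def algebra_simps)
  then have "norm (radial_push \<psi> x) = \<bar>1 + \<psi> (norm x) / norm x\<bar> * norm x"
    by simp
  also have "\<dots> = norm x + \<psi> (norm x)"
    using pos[of "norm x"] assms by (simp add: field_simps)
  finally show ?thesis .
qed

section \<open>Bilipschitz estimates and separated nets\<close>

text \<open>
  The displacement \<open>h x = \<psi> \<parallel>x\<parallel> x / \<parallel>x\<parallel>\<close> satisfies \<open>(h x - h y) \<bullet> (x - y) \<ge> 0\<close>: by the Cauchy-Schwarz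
  inequality the product is at least \<open>(\<psi> \<parallel>x\<parallel> - \<psi> \<parallel>y\<parallel>) (\<parallel>x\<parallel> - \<parallel>y\<parallel>)\<close>.  Adding \<open>h x - h y\<close> to \<open>x - y\<close>
  therefore cannot shorten it.
\<close>

lemma radial_push_expands:
  fixes x y :: "'a::euclidean_space"
  shows "dist x y \<le> dist (radial_push \<psi> x) (radial_push \<psi> y)"
proof -
  define h :: "'a \<Rightarrow> 'a" where "h z = (\<psi> (norm z) / norm z) *\<^sub>R z" for z
  have monotone_op: "(h x - h y) \<bullet> (x - y) \<ge> 0"
  proof (cases "x = 0 \<or> y = 0")
    case True
    then show ?thesis
      using pos[of "norm x"] pos[of "norm y"]
      by (cases "x = 0"; cases "y = 0") (auto simp: h_def intro!: divide_nonneg_nonneg mult_nonneg_nonneg)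
  next
    case False
    define a b where "a = norm x" and "b = norm y"
    have ab: "a > 0" "b > 0"
      using False by (auto simp: a_def b_def)
    note \<psi>pos = pos[OF ab(1)] pos[OF ab(2)]
    have "(\<psi> a / a + \<psi> b / b) * (x \<bullet> y) \<le> (\<psi> a / a + \<psi> b / b) * (a * b)"
      using \<psi>pos ab norm_cauchy_schwarz[of x y]
      by (intro mult_left_mono) (auto simp: a_def b_def)
    also have "\<dots> = \<psi> a * b + \<psi> b * a"
      using ab by (simp add: field_simps)
    finally have cs: "(\<psi> a / a + \<psi> b / b) * (x \<bullet> y) \<le> \<psi> a * b + \<psi> b * a" .
    have "0 \<le> (\<psi> a - \<psi> b) * (a - b)"
      using increasing[of a b] increasing[of b a] ab
      by (cases "a \<le> b") (auto intro: mult_nonneg_nonneg mult_nonpos_nonpos)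
    moreover have "(h x - h y) \<bullet> (x - y)
        = \<psi> a / a * (x \<bullet> x) + \<psi> b / b * (y \<bullet> y) - (\<psi> a / a + \<psi> b / b) * (x \<bullet> y)"
      by (simp add: h_def a_def b_def inner_diff_left inner_diff_right inner_commute algebra_simps)
    moreover have "\<psi> a / a * (x \<bullet> x) = \<psi> a * a" "\<psi> b / b * (y \<bullet> y) = \<psi> b * b"
      using ab by (simp_all add: a_def b_def power2_norm_eq_inner[symmetric] power2_eq_square)
    ultimately show ?thesis
      using cs by (simp add: algebra_simps)
  qed
  have eq: "radial_push \<psi> x - radial_push \<psi> y = (x - y) + (h x - h y)"
    by (simp add: radial_push_def h_def)
  have "(norm (x - y))\<^sup>2 \<le> (norm (x - y))\<^sup>2 + 2 * ((h x - h y) \<bullet> (x - y)) + (norm (h x - h y))\<^sup>2"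
    using monotone_op by simp
  also have "\<dots> = (norm (radial_push \<psi> x - radial_push \<psi> y))\<^sup>2"
    unfolding eq power2_norm_eq_inner
    by (simp only: inner_add_left inner_add_right inner_commute[of "x - y" "h x - h y"])
  finally show ?thesis
    unfolding dist_norm by (rule power2_le_imp_le) simp
qed

lemma inj_on_radial_push: "inj_on (radial_push \<psi>) X"
proof (rule inj_onI)
  fix x y assume "radial_push \<psi> x = radial_push \<psi> y"
  then show "x = y"
    using radial_push_expands[of x y] by simp
qed

lemma norm_le_radial_push:
  fixes x :: "'a::euclidean_space"
  shows "norm x \<le> norm (radial_push \<psi> x)"
  using radial_push_expands[of x 0] by (simp add: radial_push_def)

text \<open>
  With \<open>\<theta> t = \<psi> t / t\<close> and \<open>\<parallel>y\<parallel> \<le> \<parallel>x\<parallel>\<close>, the displacements differ by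
  \<open>\<theta> \<parallel>x\<parallel> (x - y) - (\<theta> \<parallel>y\<parallel> - \<theta> \<parallel>x\<parallel>) y\<close>, and the second summand is at most
  \<open>\<theta> \<parallel>x\<parallel> (\<parallel>x\<parallel> - \<parallel>y\<parallel>)\<close> in norm because \<open>\<psi> \<parallel>y\<parallel> \<le> \<psi> \<parallel>x\<parallel>\<close>.  Only the larger norm
  enters the bound: a vanishing norm of \<open>y\<close> does no harm, although \<open>\<psi>\<close> may be steep at \<open>0\<close>.
\<close>

lemma radial_push_stretch:
  fixes x y :: "'a::euclidean_space"
  assumes "norm x \<ge> r \<or> norm y \<ge> r" "r > 0"
  shows "dist (radial_push \<psi> x) (radial_push \<psi> y) \<le> (1 + 2 * (\<psi> r / r)) * dist x y"
proof -
  have ordered: "dist (radial_push \<psi> x) (radial_push \<psi> y) \<le> (1 + 2 * (\<psi> r / r)) * dist x y"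
    if xy: "norm y \<le> norm x" and rx: "r \<le> norm x" for x y :: 'a
  proof -
    define a b where "a = norm x" and "b = norm y"
    define A B where "A = \<psi> a / a" and "B = \<psi> b / b"
    have a: "a > 0" "r \<le> a" "b \<le> a" "0 \<le> b"
      using xy rx \<open>r > 0\<close> by (auto simp: a_def b_def)
    have A: "0 \<le> A" "A \<le> \<psi> r / r"
      using pos[of a] a ratio_decreasing[of r a] \<open>r > 0\<close> by (auto simp: A_def)
    have "\<bar>A - B\<bar> * b \<le> A * (a - b)"
    proof (cases "b = 0")
      case True
      then show ?thesis using A a by simp
    next
      case False
      then have "A \<le> B" "\<psi> b \<le> \<psi> a"
        using a ratio_decreasing[of b a] increasing[of b a] by (auto simp: A_def B_def)
      moreover have "B * b = \<psi> b" "A * a = \<psi> a"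
        using a False by (auto simp: A_def B_def)
      ultimately show ?thesis
        by (simp add: algebra_simps)
    qed
    also have "\<dots> \<le> A * norm (x - y)"
      using A norm_triangle_ineq2[of x y] by (intro mult_left_mono) (auto simp: a_def b_def)
    finally have second: "norm ((A - B) *\<^sub>R y) \<le> A * norm (x - y)"
      by (simp add: b_def)
    have "radial_push \<psi> x - radial_push \<psi> y = (x - y) + (A *\<^sub>R (x - y) + (A - B) *\<^sub>R y)"
      by (simp add: radial_push_def A_def B_def a_def b_def algebra_simps)
    also have "norm \<dots> \<le> norm (x - y) + (norm (A *\<^sub>R (x - y)) + norm ((A - B) *\<^sub>R y))"
      by (intro norm_triangle_le add_left_mono norm_triangle_ineq)
    also have "\<dots> \<le> norm (x - y) + 2 * (A * norm (x - y))"
      using second A by simp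
    also have "\<dots> \<le> norm (x - y) + 2 * (\<psi> r / r * norm (x - y))"
      using A by (intro add_left_mono mult_left_mono mult_right_mono) auto
    finally show ?thesis
      by (simp add: dist_norm algebra_simps)
  qed
  show ?thesis
    using ordered[of x y] ordered[of y x] assms by (cases "norm y \<le> norm x") (auto simp: dist_commute)
qed

lemma bij_betw_radial_push: "bij_betw (radial_push \<psi>) X (radial_push \<psi> ` X)"
  using inj_on_radial_push by (rule inj_on_imp_bij_betw)

lemma separated_radial_push:
  assumes "separated X"
  shows "separated (radial_push \<psi> ` X)"
proof -
  obtain \<delta> where \<delta>: "\<delta> > 0" "\<And>z z'. z \<in> X \<Longrightarrow> z' \<in> X \<Longrightarrow> z \<noteq> z' \<Longrightarrow> \<delta> \<le> dist z z'"
    using assms unfolding separated_iff by blast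
  have "\<delta> \<le> dist (radial_push \<psi> z) (radial_push \<psi> z')" if "z \<in> X" "z' \<in> X" "z \<noteq> z'" for z z'
    using \<delta>(2)[OF that] radial_push_expands[of z z'] by linarith
  then show ?thesis
    unfolding separated_iff using \<delta>(1) by blast
qed

text \<open>
  Outside a ball the push is onto, by the intermediate value theorem along rays, and Lipschitz.
  Points close to the origin, which the push may miss when \<open>\<psi>\<close> has a positive limit at \<open>0\<close>,
  are near any fixed point of the image.
\<close>

lemma net_radial_push:
  fixes X :: "'a::euclidean_space set"
  assumes "net X"
  shows "net (radial_push \<psi> ` X)"
proof -
  obtain \<rho> where \<rho>: "\<And>x. \<exists>z\<in>X. dist z x \<le> \<rho>"
    using assms unfolding net_iff by blast
  obtain z0 where z0: "z0 \<in> X"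
    using \<rho> by blast
  define r1 where "r1 = norm (radial_push \<psi> z0) + (1 + \<psi> 1)"
  define r2 where "r2 = (1 + 2 * (\<psi> 1 / 1)) * \<rho>"
  have "\<exists>z\<in>radial_push \<psi> ` X. dist z p \<le> max r1 r2" for p
  proof (cases "norm p \<le> 1 + \<psi> 1")
    case True
    have "dist (radial_push \<psi> z0) p \<le> r1"
      using True norm_triangle_ineq4[of "radial_push \<psi> z0" p] by (simp add: r1_def dist_norm)
    then have "dist (radial_push \<psi> z0) p \<le> max r1 r2"
      by simp
    then show ?thesis
      using z0 by blast
  next
    case False
    have "continuous_on {0<..} (\<lambda>t. - \<psi> t)"
      using concave by (intro convex_on_continuous) (auto simp: concave_on_def)
    then have "continuous_on {0<..} \<psi>"
      using continuous_on_minus by fastforce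
    then have "continuous_on {1..norm p} (\<lambda>t. t + \<psi> t)"
      by (intro continuous_intros) (auto elim: continuous_on_subset)
    moreover have "norm p \<ge> 1"
      using False pos[of 1] by simp
    moreover from this have "\<psi> (norm p) > 0"
      by (intro pos) linarith
    ultimately obtain t where t: "1 \<le> t" "t + \<psi> t = norm p"
      using IVT'[of "\<lambda>t. t + \<psi> t" 1 "norm p" "norm p"] False by auto
    define x where "x = (t / norm p) *\<^sub>R p"
    have p: "p \<noteq> 0"
      using \<open>norm p \<ge> 1\<close> by auto
    have nx: "norm x = t"
      using t p by (simp add: x_def)
    have "radial_push \<psi> x = ((t + \<psi> t) / norm p) *\<^sub>R p"
      using t(1) p unfolding radial_push_def nx
      by (simp add: x_def add_divide_distrib scaleR_add_left)
    then have gx: "radial_push \<psi> x = p"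
      using t p by simp
    obtain z where z: "z \<in> X" "dist z x \<le> \<rho>"
      using \<rho> by blast
    have "dist (radial_push \<psi> z) (radial_push \<psi> x) \<le> (1 + 2 * (\<psi> 1 / 1)) * dist z x"
      using t nx by (intro radial_push_stretch) auto
    also have "\<dots> \<le> r2"
      unfolding r2_def using z pos[of 1] by (intro mult_left_mono) auto
    finally have "dist (radial_push \<psi> z) p \<le> max r1 r2"
      using gx by simp
    then show ?thesis
      using z(1) by blast
  qed
  then show ?thesis
    unfolding net_iff by blast
qed

lemma bilipschitz_equivalent_radial_push:
  fixes X :: "'a::euclidean_space set"
  assumes "separated X"
  shows "bilipschitz_equivalent X (radial_push \<psi> ` X)"
proof -
  obtain \<delta> where \<delta>: "\<delta> > 0" "\<And>z z'. z \<in> X \<Longrightarrow> z' \<in> X \<Longrightarrow> z \<noteq> z' \<Longrightarrow> \<delta> \<le> dist z z'"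
    using assms unfolding separated_iff by blast
  define L where "L = 1 + 2 * (\<psi> (\<delta> / 2) / (\<delta> / 2))"
  have "L-lipschitz_on X (radial_push \<psi>)"
  proof (rule lipschitz_onI)
    show "0 \<le> L"
      using pos[of "\<delta> / 2"] \<delta>(1) by (simp add: L_def)
    fix x y assume xy: "x \<in> X" "y \<in> X"
    show "dist (radial_push \<psi> x) (radial_push \<psi> y) \<le> L * dist x y"
    proof (cases "x = y")
      case False
      then have "\<delta> \<le> norm x + norm y"
        using \<delta>(2)[OF xy] norm_triangle_ineq4[of x y] by (simp add: dist_norm)
      then have "norm x \<ge> \<delta> / 2 \<or> norm y \<ge> \<delta> / 2"
        by linarith
      then show ?thesis
        unfolding L_def using \<delta>(1) by (intro radial_push_stretch) auto
    qed simp
  qed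
  moreover have "1-lipschitz_on (radial_push \<psi> ` X) (inv_into X (radial_push \<psi>))"
    by (rule lipschitz_onI)
      (auto simp: inv_into_f_f[OF inj_on_radial_push] radial_push_expands)
  ultimately show ?thesis
    unfolding bilipschitz_equivalent_def using bij_betw_radial_push by blast
qed

section \<open>Upper and lower bounds on displacements\<close>

lemma disp_radial_push:
  assumes "R > 0"
  shows "\<bar>disp X (radial_push \<psi>) R\<bar> \<le> \<psi> R"
    and "\<bar>disp (radial_push \<psi> ` X) (inv_into X (radial_push \<psi>)) R\<bar> \<le> \<psi> R"
proof -
  have bound: "\<bar>disp A f R\<bar> \<le> \<psi> R"
    if f: "\<And>x. x \<in> A \<inter> cball 0 R \<Longrightarrow> norm (f x - x) \<le> \<psi> R" for A and f :: "'a \<Rightarrow> 'a"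
  proof (cases "A \<inter> cball 0 R = {}")
    case True
    then show ?thesis
      using pos[OF assms] by (simp add: disp_def)
  next
    case False
    then have "\<bar>SUP x\<in>A \<inter> cball 0 R. norm (f x - x)\<bar> \<le> \<psi> R"
      using f by (intro cSup_abs_le) auto
    then show ?thesis
      using False by (simp add: disp_def)
  qed
  show "\<bar>disp X (radial_push \<psi>) R\<bar> \<le> \<psi> R"
    using assms by (intro bound norm_displacement_le) auto
  show "\<bar>disp (radial_push \<psi> ` X) (inv_into X (radial_push \<psi>)) R\<bar> \<le> \<psi> R"
  proof (rule bound)
    fix y assume "y \<in> radial_push \<psi> ` X \<inter> cball 0 R"
    then obtain x where x: "x \<in> X" "y = radial_push \<psi> x" "norm y \<le> R"
      by auto
    have "inv_into X (radial_push \<psi>) y = x"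
      using x by (simp add: inv_into_f_f[OF inj_on_radial_push])
    moreover have "norm x \<le> R"
      using x norm_le_radial_push[of x] by simp
    ultimately show "norm (inv_into X (radial_push \<psi>) y - y) \<le> \<psi> R"
      using norm_displacement_le[of x R] assms x by (simp add: norm_minus_commute)
  qed
qed

text \<open>
  Where \<open>\<psi> R \<le> R\<close>, a preimage \<open>x\<close> of norm above \<open>R - \<psi> R / 2\<close> would have norm at least \<open>R / 2\<close>, hence
  \<open>\<psi> \<parallel>x\<parallel> \<ge> \<psi> R / 2\<close> by concavity, and would be pushed out of the ball of radius \<open>R\<close>.
\<close>

lemma norm_preimage_le:
  fixes x :: "'a::euclidean_space"
  assumes "norm (radial_push \<psi> x) \<le> R" "R > 0" "\<psi> R \<le> R"
  shows "norm x \<le> R - \<psi> R / 2"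
proof (rule ccontr)
  assume "\<not> norm x \<le> R - \<psi> R / 2"
  then have far: "norm x > R - \<psi> R / 2"
    by simp
  then have x: "x \<noteq> 0" "norm x \<ge> R / 2"
    using assms by auto
  have xR: "norm x \<le> R"
    using assms norm_le_radial_push[of x] by simp
  have "\<psi> R / 2 = \<psi> R / R * (R / 2)"
    using assms by simp
  also have "\<dots> \<le> \<psi> R / R * norm x"
    using assms x pos[of R] by (intro mult_left_mono) auto
  also have "\<dots> \<le> \<psi> (norm x)"
    using ratio_decreasing[of "norm x" R] x xR by (simp add: field_simps)
  finally show False
    using far assms norm_radial_push[of x] x by simp
qed

text \<open>
  The bijection \<open>f\<close> would put the points of \<open>X\<close> of norm at most \<open>R - \<psi> R / 4\<close> injectively into the ball
  of radius \<open>R\<close>, which contains at most as many points of the image as there are points of \<open>X\<close> of norm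
  at most \<open>R - \<psi> R / 2\<close>.  The annulus in between is wide enough to contain a closed ball of radius
  \<open>\<rho>\<close>, and hence a further point of \<open>X\<close>.
\<close>

lemma not_less_displaced:
  fixes X :: "'a::euclidean_space set"
  assumes "separated X" and \<rho>: "\<And>x. \<exists>z\<in>X. dist z x \<le> \<rho>"
    and f: "bij_betw f X (radial_push \<psi> ` X)"
    and R: "R > 0" "\<psi> R \<le> R" "\<psi> R > 8 * \<rho>"
  shows "disp X f R > \<psi> R / 4"
proof (rule ccontr)
  assume "\<not> disp X f R > \<psi> R / 4"
  then have small: "disp X f R \<le> \<psi> R / 4"
    by simp
  define A where "A = X \<inter> cball 0 (R - \<psi> R / 4)"
  define B where "B = X \<inter> cball 0 (R - \<psi> R / 2)"
  have \<psi>R: "\<psi> R > 0"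
    using pos R by simp
  have fin: "finite A" "finite B"
    using separated_finite_Int_cball[OF assms(1)] by (auto simp: A_def B_def)
  have "f ` A \<subseteq> radial_push \<psi> ` B"
  proof
    fix y assume "y \<in> f ` A"
    then obtain x where x: "x \<in> X" "norm x \<le> R - \<psi> R / 4" "y = f x"
      by (auto simp: A_def)
    have mem: "x \<in> X \<inter> cball 0 R"
      using x \<psi>R by simp
    have "norm (f x - x) \<le> (SUP x\<in>X \<inter> cball 0 R. norm (f x - x))"
      using mem separated_finite_Int_cball[OF assms(1)] by (intro cSUP_upper) auto
    also have "\<dots> = disp X f R"
      using mem by (auto simp: disp_def)
    finally have "norm y \<le> R"
      using small x norm_triangle_sub[of "f x" x] by simp
    moreover obtain z where z: "z \<in> X" "y = radial_push \<psi> z"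
      using f x by (auto simp: bij_betw_def)
    ultimately show "y \<in> radial_push \<psi> ` B"
      using norm_preimage_le[of z R] R by (auto simp: B_def)
  qed
  then have "card (f ` A) \<le> card B"
    using fin by (meson card_image_le card_mono finite_imageI order_trans)
  moreover have "card (f ` A) = card A"
    using f by (intro card_image) (auto simp: A_def bij_betw_def inj_on_def)
  moreover have "B \<subseteq> A"
    using \<psi>R by (auto simp: A_def B_def)
  ultimately have "A = B"
    using fin card_seteq by metis
  (* The middle radius of the annulus. *)
  have "R - 3 * \<psi> R / 8 \<ge> 0"
    using R \<psi>R by simp
  then obtain p :: 'a where p: "norm p = R - 3 * \<psi> R / 8"
    using vector_choose_size by blast
  obtain z where z: "z \<in> X" "norm (z - p) \<le> \<rho>"
    using \<rho>[of p] by (auto simp: dist_norm)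
  have "z \<in> A" "z \<notin> B"
    using z p R norm_triangle_ineq3[of z p] by (auto simp: A_def B_def)
  then show False
    using \<open>A = B\<close> by simp
qed

end

section \<open>Nets that need displacement of a prescribed order\<close>

theorem theorem4p1:
  fixes \<phi> :: "real \<Rightarrow> real" and X :: "(real ^ 'd) set"
  assumes "\<And>R. R > 0 \<Longrightarrow> \<phi> R > 0"
    and "mono_on {0<..} \<phi>"
    and "concave_on {0<..} \<phi>"
    and "\<phi> \<in> o[at_top](\<lambda>R. R)"
    and "separated_net X"
  shows "\<exists>Y :: (real ^ 'd) set.
    separated_net Y \<and>
    (\<forall>f. bij_betw f X Y \<longrightarrow> disp X f \<notin> o[at_top](\<phi>)) \<and>
    (\<exists>g. bij_betw g X Y \<and> disp X g \<in> O[at_top](\<phi>) \<and> disp Y (inv_into X g) \<in> O[at_top](\<phi>)) \<and>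
    bilipschitz_equivalent X Y"
proof -
  have X: "separated X" "net X"
    using assms(5) by (auto simp: separated_net_def)
  obtain \<rho> where \<rho>: "\<And>x. \<exists>z\<in>X. dist z x \<le> \<rho>"
    using X(2) unfolding net_iff by blast
  obtain z where "z \<in> X" "dist z 0 \<le> \<rho>"
    using \<rho> by blast
  then have "\<rho> \<ge> 0"
    using zero_le_dist[of z 0] by linarith
  define C where "C = (8 * \<rho> + 1) / \<phi> 1"
  have C: "C > 0"
    using assms(1)[of 1] \<open>\<rho> \<ge> 0\<close> by (simp add: C_def)
  define \<psi> where "\<psi> = (\<lambda>t. C * \<phi> t)"
  interpret concave_profile \<psi>
  proof
    show "\<psi> t > 0" if "t > 0" for t
      using assms(1) C that by (simp add: \<psi>_def)
    show "mono_on {0<..} \<psi>"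
      using assms(2) C by (auto simp: \<psi>_def mono_on_def)
    show "concave_on {0<..} \<psi>"
      using concave_on_cmul[of C "{0<..}" \<phi>] assms(3) C by (simp add: \<psi>_def)
  qed
  have big: "disp X f \<notin> o[at_top](\<phi>)" if f: "bij_betw f X (radial_push \<psi> ` X)" for f
  proof
    assume "disp X f \<in> o[at_top](\<phi>)"
    then have "eventually (\<lambda>R. norm (disp X f R) \<le> C / 4 * norm (\<phi> R)) at_top"
      using C by (intro landau_o.smallD) auto
    moreover have "eventually (\<lambda>R. norm (\<phi> R) \<le> 1 / C * norm R) at_top"
      using C assms(4) by (intro landau_o.smallD) auto
    ultimately have "eventually (\<lambda>R. norm (disp X f R) \<le> C / 4 * norm (\<phi> R)
        \<and> norm (\<phi> R) \<le> 1 / C * norm R \<and> R \<ge> 1) at_top"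
      using eventually_ge_at_top[of 1] by eventually_elim auto
    then obtain R where R: "norm (disp X f R) \<le> C / 4 * norm (\<phi> R)"
        "norm (\<phi> R) \<le> 1 / C * norm R" "R \<ge> 1"
      unfolding eventually_at_top_linorder by blast
    have \<phi>R: "\<phi> R > 0"
      using assms(1) R by simp
    have "\<psi> R \<le> R"
      using R \<phi>R C by (simp add: \<psi>_def field_simps)
    moreover have "\<psi> R > 8 * \<rho>"
      using increasing[of 1 R] assms(1)[of 1] R by (simp add: \<psi>_def C_def)
    ultimately have "disp X f R > \<psi> R / 4"
      using X \<rho> f R by (intro not_less_displaced) auto
    then show False
      using R \<phi>R by (simp add: \<psi>_def)
  qed
  have O: "u \<in> O[at_top](\<phi>)" if "\<And>R. R > 0 \<Longrightarrow> \<bar>u R\<bar> \<le> \<psi> R" for u :: "real \<Rightarrow> real"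
  proof (rule bigoI)
    show "eventually (\<lambda>R. norm (u R) \<le> C * norm (\<phi> R)) at_top"
      using eventually_gt_at_top[of 0]
    proof eventually_elim
      case (elim R)
      then show ?case
        using that[of R] assms(1)[of R] by (simp add: \<psi>_def)
    qed
  qed
  show ?thesis
  proof (intro exI[of _ "radial_push \<psi> ` X"] exI[of _ "radial_push \<psi>"] conjI allI impI)
    show "separated_net (radial_push \<psi> ` X)"
      using separated_radial_push[OF X(1)] net_radial_push[OF X(2)] by (simp add: separated_net_def)
    show "disp X f \<notin> o[at_top](\<phi>)" if "bij_betw f X (radial_push \<psi> ` X)" for f
      using that by (rule big)
    show "bij_betw (radial_push \<psi>) X (radial_push \<psi> ` X)"
      by (rule bij_betw_radial_push)
    show "disp X (radial_push \<psi>) \<in> O[at_top](\<phi>)"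
      by (intro O disp_radial_push)
    show "disp (radial_push \<psi> ` X) (inv_into X (radial_push \<psi>)) \<in> O[at_top](\<phi>)"
      by (intro O disp_radial_push)
    show "bilipschitz_equivalent X (radial_push \<psi> ` X)"
      using X(1) by (rule bilipschitz_equivalent_radial_push)
  qed
qed

end
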